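(* There exists a weight $w$ on $\mathbb{T}$ satisfying condition (A) such that the system $E(\mathbb{N}\setminus\{k^2:k\in\mathbb{N}\})$ does not span $L^2(\mathbb{T},w)$.
   Context: $\mathbb{N}=\{1,2,3,\dots\}$ and $\mathbb{T}=[0,1]$ is the circle. A weight $w$ on $\mathbb{T}$ is a nonnegative function with finite integral. For a discrete set $\Lambda\subset\mathbb{R}$, $E(\Lambda):=\{e^{2\pi i\lambda t}:\lambda\in\Lambda\}$. $L^2(\mathbb{T},w)$ is the space of functions $f$ on $\mathbb{T}$ with $\int_0^1|f(t)|^2w(t)\,dt<\infty$; a system spans this space if its finite linear combinations are dense in it (i.e. the system is complete). Condition (A) on a weight $w$: $w$ is positive, increasing and bounded on $(0,1)$ and satisfies $\int_0^1\log w(t)\,dt=-\infty$. *)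

theory Defs
  imports "HOL-Analysis.Analysis"
begin

text \<open>
  The circle is the interval \<open>{0..1}\<close> with Lebesgue measure.  Functions on it are represented by
  functions on all of \<open>real\<close>, whose values outside \<open>{0..1}\<close> are irrelevant.
\<close>

definition is_weight :: "(real \<Rightarrow> real) \<Rightarrow> bool" where
  "is_weight w \<longleftrightarrow>
     (\<forall>t\<in>{0..1}. 0 \<le> w t) \<and> integrable (lebesgue_on {0..1}) w"

text \<open>
  The integral of a measurable function over the circle, in the extended sense, is \<open>-\<infinity>\<close>:
  its positive part has a finite integral and its negative part an infinite one.  (The
  Bochner integral takes only finite values and is \<open>0\<close> for a nonintegrable function.)
\<close>

definition integral_eq_MInf :: "(real \<Rightarrow> real) \<Rightarrow> bool" where
  "integral_eq_MInf g \<longleftrightarrow>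
     g \<in> borel_measurable (lebesgue_on {0..1}) \<and>
     (\<integral>\<^sup>+ t. ennreal (g t) \<partial>lebesgue_on {0..1}) < \<infinity> \<and>
     (\<integral>\<^sup>+ t. ennreal (- g t) \<partial>lebesgue_on {0..1}) = \<infinity>"

text \<open>``Increasing'' is read strictly.\<close>

definition condition_A :: "(real \<Rightarrow> real) \<Rightarrow> bool" where
  "condition_A w \<longleftrightarrow>
     (\<forall>t\<in>{0<..<1}. 0 < w t) \<and>
     strict_mono_on {0<..<1} w \<and>
     bounded (w ` {0<..<1}) \<and>
     integral_eq_MInf (\<lambda>t. ln (w t))"

definition L2_normsq :: "(real \<Rightarrow> real) \<Rightarrow> (real \<Rightarrow> complex) \<Rightarrow> ennreal" where
  "L2_normsq w f = (\<integral>\<^sup>+ t. ennreal ((cmod (f t))\<^sup>2 * w t) \<partial>lebesgue_on {0..1})"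

definition L2_space :: "(real \<Rightarrow> real) \<Rightarrow> (real \<Rightarrow> complex) set" where
  "L2_space w = {f. f \<in> borel_measurable (lebesgue_on {0..1}) \<and> L2_normsq w f < \<infinity>}"

definition exp_system :: "real set \<Rightarrow> (real \<Rightarrow> complex) set" where
  "exp_system \<Lambda> = (\<lambda>l t. exp (2 * of_real pi * \<i> * of_real l * of_real t)) ` \<Lambda>"

definition finite_combinations :: "(real \<Rightarrow> complex) set \<Rightarrow> (real \<Rightarrow> complex) set" where
  "finite_combinations S = {(\<lambda>t. \<Sum>e\<in>F. c e * e t) | F c. finite F \<and> F \<subseteq> S}"

definition spans_L2 :: "(real \<Rightarrow> complex) set \<Rightarrow> (real \<Rightarrow> real) \<Rightarrow> bool" where
  "spans_L2 S w \<longleftrightarrow>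
     (\<forall>f\<in>L2_space w. \<forall>\<epsilon>>0. \<exists>p\<in>finite_combinations S.
        L2_normsq w (\<lambda>t. f t - p t) < ennreal (\<epsilon>\<^sup>2))"

end

theory Submission
  imports Defs "HOL-Computational_Algebra.Polynomial"
begin

text \<open>
  A function \<open>F \<noteq> 0\<close> obstructs completeness if it integrates to \<open>0\<close> against every member of the
  system and is dominated by \<open>w\<close>, for then \<open>F / w\<close> defines a bounded functional on the weighted space.  A weight
  that increases on \<open>(0, 1)\<close> and has divergent logarithmic integral must be very small at \<open>0\<close>;
  the weight \<open>exp (- d / t)\<close> just meets this requirement.  So it suffices to find a
  nonzero function whose spectrum avoids the positive non-squares and that is as small as \<open>exp (- d / t)\<close>
  to the right of \<open>0\<close>.

  The function used is \<open>F t = 1 - (\<Sum>k\<ge>1. l k * cos (2 \<pi> k\<^sup>2 t))\<close>, with spectrum in \<open>{0, \<plusminus>k\<^sup>2}\<close>.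
  All derivatives of \<open>F\<close> vanish at \<open>0\<close> as soon as \<open>(\<Sum>k\<ge>1. l k * k\<^sup>4\<^sup>m)\<close> is \<open>1\<close> for \<open>m = 0\<close> and
  \<open>0\<close> for \<open>m > 0\<close>.  This says that the coefficients recover the value at \<open>0\<close> of every
  polynomial from its values at the nodes \<open>k\<^sup>4\<close>.  For finitely many nodes \<open>1, \<dots>, N\<^sup>4\<close> this is Lagrange
  interpolation (\<open>sum_quartic_coeff_powers\<close>).  The interpolation weights are bounded by
  \<open>4 / 2\<^sup>k\<close> uniformly in \<open>N\<close> (\<open>abs_quartic_coeff_le\<close>) and converge, so dominated
  convergence gives the infinite system (\<open>flat_coeff_moments\<close>).

  Because the coefficients decay geometrically in \<open>k\<close> while the frequencies grow like \<open>k\<^sup>2\<close>, the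
  \<open>n\<close>-th derivative of \<open>F\<close> is at most of the order of \<open>(2 n)!\<close>, up to a geometric factor.
  Taylor's formula at the flat point gives \<open>\<bar>F t\<bar> \<le> K (A n t)\<^sup>n\<close> for all \<open>n\<close>, and the best choice of \<open>n\<close> yields
  \<open>\<bar>F t\<bar> \<le> C exp (- d / t)\<close> (\<open>flat_fun_exp_bound\<close>).  Taking \<open>w t = exp (- d / t)\<close>, the function
  \<open>F\<close> annihilates every \<open>exp (2 \<pi> \<i> n t)\<close> with \<open>n \<ge> 1\<close> not a square, while its integral is \<open>1\<close>,
  so the constant \<open>1\<close> cannot be approximated (\<open>not_spans_L2_if_annihilated\<close>).
\<close>

section \<open>Lagrange interpolation at zero with fourth powers as nodes\<close>

text \<open>
  A polynomial of degree below the number of nodes is its own Lagrange interpolant.  Only the value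
  of the interpolant at \<open>0\<close> matters here, and that turns the interpolation formula into a
  system of linear relations between the basis values at \<open>0\<close>.
\<close>

lemma Lagrange_interpolation_at_0:
  fixes x :: "'b \<Rightarrow> 'a::field" and p :: "'a poly"
  assumes fin: "finite A" and inj: "inj_on x A" and deg: "degree p < card A"
  shows "(\<Sum>k\<in>A. poly p (x k) * (\<Prod>j\<in>A - {k}. x j / (x j - x k))) = poly p 0"
proof -
  define b where "b = (\<lambda>k. smult (1 / (\<Prod>j\<in>A - {k}. x j - x k)) (\<Prod>j\<in>A - {k}. [:x j, -1:]))"
  define q where "q = (\<Sum>k\<in>A. smult (poly p (x k)) (b k))"
  have poly_b: "poly (b k) y = (\<Prod>j\<in>A - {k}. (x j - y) / (x j - x k))" for k y
    by (simp add: b_def poly_prod prod_dividef)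
  have "degree (b k) < card A" if "k \<in> A" for k
  proof -
    have "degree (b k) \<le> degree (\<Prod>j\<in>A - {k}. [:x j, -1:])"
      unfolding b_def by (rule degree_smult_le)
    also have "\<dots> \<le> sum (degree \<circ> (\<lambda>j. [:x j, -1:])) (A - {k})"
      using fin by (intro degree_prod_sum_le) auto
    also have "\<dots> = card A - 1"
      using that fin by simp
    finally show ?thesis
      using that fin card_gt_0_iff[of A] by auto
  qed
  then have deg_q: "degree q < card A"
    unfolding q_def using deg by (intro degree_sum_less) (auto intro: le_less_trans[OF degree_smult_le])
  have kron: "poly (b k) (x i) = (if k = i then 1 else 0)" if "k \<in> A" "i \<in> A" for k i
  proof (cases "k = i")
    case True
    have "(x j - x i) / (x j - x i) = 1" if "j \<in> A - {i}" for j
      using inj that \<open>i \<in> A\<close> by (auto dest: inj_onD)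
    then show ?thesis using True by (simp add: poly_b)
  next
    case False
    then have "i \<in> A - {k}" using that by auto
    then have "poly (b k) (x i) = 0"
      unfolding poly_b using fin by (intro prod_zero) auto
    then show ?thesis using False by simp
  qed
  have "q = p"
  proof (rule poly_eqI_degree[where A = "x ` A"])
    fix y assume "y \<in> x ` A"
    then obtain i where i: "i \<in> A" "y = x i" by auto
    have "poly q y = (\<Sum>k\<in>A. poly p (x k) * (if k = i then 1 else 0))"
      unfolding q_def poly_sum using i kron by (intro sum.cong) auto
    then show "poly q y = poly p y"
      using i fin by (simp add: if_distrib[of "\<lambda>c. _ * c"] cong: if_cong)
  qed (use deg deg_q inj in \<open>auto simp: card_image\<close>)
  then have "poly p 0 = poly q 0" by simp
  also have "\<dots> = (\<Sum>k\<in>A. poly p (x k) * (\<Prod>j\<in>A - {k}. x j / (x j - x k)))"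
    by (simp add: q_def poly_sum poly_b)
  finally show ?thesis ..
qed

text \<open>
  The value at \<open>0\<close> of the \<open>k\<close>-th Lagrange basis polynomial for the nodes
  \<open>1\<^sup>4, \<dots>, N\<^sup>4\<close>.  It is extended by \<open>0\<close> to the other indices so that sums over the nodes
  become series, to which dominated convergence applies as \<open>N\<close> grows.
\<close>

definition quartic_coeff :: "nat \<Rightarrow> nat \<Rightarrow> real" where
  "quartic_coeff N k =
     (if k \<in> {1..N} then \<Prod>j\<in>{1..N} - {k}. real j ^ 4 / (real j ^ 4 - real k ^ 4) else 0)"

text \<open>
  Interpolation of the monomial \<open>x\<^sup>m\<close>, whose value at \<open>0\<close> is \<open>0\<close> unless \<open>m = 0\<close>.
\<close>

lemma sum_quartic_coeff_powers:
  assumes "m < N"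
  shows "(\<Sum>k\<in>{1..N}. quartic_coeff N k * real k ^ (4 * m)) = (if m = 0 then 1 else 0)"
proof -
  have inj: "inj_on (\<lambda>k. real k ^ 4) {1..N}"
    by (auto simp: inj_on_def power_eq_iff_eq_base)
  have "(\<Sum>k\<in>{1..N}. quartic_coeff N k * real k ^ (4 * m)) =
    (\<Sum>k\<in>{1..N}. poly (monom 1 m) (real k ^ 4) *
       (\<Prod>j\<in>{1..N} - {k}. real j ^ 4 / (real j ^ 4 - real k ^ 4)))"
    by (intro sum.cong) (auto simp: quartic_coeff_def poly_monom power_mult)
  also have "\<dots> = poly (monom 1 m) 0"
    using assms by (intro Lagrange_interpolation_at_0[OF _ inj]) (auto simp: degree_monom_eq)
  finally show ?thesis by (simp add: poly_monom power_0_left)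
qed

text \<open>
  Since \<open>k\<^sup>2 - j\<^sup>2 = (k - j) (k + j)\<close>, the product over \<open>j\<close> is a quotient of factorials.  The
  nodes below \<open>k\<close> are treated alone; the next lemma then adds those above \<open>k\<close>.
\<close>

lemma prod_square_ratio_below:
  assumes "n < k"
  shows "(\<Prod>j\<in>{1..n}. real j ^ 2 / (real k ^ 2 - real j ^ 2)) * (fact (k - 1) * fact (k + n)) =
         fact n ^ 2 * fact (k - 1 - n) * fact k"
  using assms
proof (induction n)
  case (Suc n)
  define P where "P = (\<Prod>j\<in>{1..n}. real j ^ 2 / (real k ^ 2 - real j ^ 2))"
  have IH: "P * (fact (k - 1) * fact (k + n)) = fact n ^ 2 * fact (k - 1 - n) * fact k"
    using Suc unfolding P_def by simp
  have diff: "real k ^ 2 - real (Suc n) ^ 2 = (real k - real (Suc n)) * (real k + real (Suc n))"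
    by (simp add: power2_eq_square algebra_simps)
  have nz: "real k - real (Suc n) \<noteq> 0" "real k + real (Suc n) \<noteq> 0"
    using Suc.prems by auto
  have "k - 1 - n = Suc (k - 1 - Suc n)"
    using Suc.prems by auto
  then have down: "(fact (k - 1 - n) :: real) = (real k - real (Suc n)) * fact (k - 1 - Suc n)"
    using Suc.prems by (simp only: fact_Suc) (simp add: of_nat_diff)
  have up: "(fact (k + Suc n) :: real) = (real k + real (Suc n)) * fact (k + n)"
    by simp
  have prodS: "(\<Prod>j\<in>{1..Suc n}. real j ^ 2 / (real k ^ 2 - real j ^ 2)) =
      P * (real (Suc n) ^ 2 / ((real k - real (Suc n)) * (real k + real (Suc n))))"
    unfolding P_def diff[symmetric] by simp
  have "(\<Prod>j\<in>{1..Suc n}. real j ^ 2 / (real k ^ 2 - real j ^ 2)) * (fact (k - 1) * fact (k + Suc n))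
      = P * (fact (k - 1) * fact (k + n)) * real (Suc n) ^ 2 / (real k - real (Suc n))"
    unfolding up prodS using nz by simp
  also have "\<dots> = fact (Suc n) ^ 2 * fact (k - 1 - Suc n) * fact k"
    unfolding IH down fact_Suc[of n] using nz by (simp add: power_mult_distrib)
  finally show ?case .
qed auto

lemma prod_square_ratio:
  assumes "1 \<le> k" "k \<le> N"
  shows "(\<Prod>j\<in>{1..N} - {k}. \<bar>real j ^ 2 / (real j ^ 2 - real k ^ 2)\<bar>) * (fact (N - k) * fact (N + k)) =
         2 * fact N ^ 2"
  using assms(2)
proof (induction N rule: dec_induct)
  case base
  obtain l where l: "k = Suc l" using assms(1) by (cases k) auto
  define P where "P = (\<Prod>j\<in>{1..l}. real j ^ 2 / (real k ^ 2 - real j ^ 2))"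
  have "(\<Prod>j\<in>{1..k} - {k}. \<bar>real j ^ 2 / (real j ^ 2 - real k ^ 2)\<bar>) = P"
    unfolding P_def
  proof (rule prod.cong)
    fix j assume "j \<in> {1..l}"
    then have "real j ^ 2 < real k ^ 2" using l by (intro power_strict_mono) auto
    then show "\<bar>real j ^ 2 / (real j ^ 2 - real k ^ 2)\<bar> = real j ^ 2 / (real k ^ 2 - real j ^ 2)"
      by (simp add: abs_of_neg)
  qed (use l in auto)
  moreover have "P * fact (k + k) = 2 * fact k ^ 2"
  proof -
    have "P * (fact l * fact (k + l)) = fact l ^ 2 * fact k"
      using prod_square_ratio_below[of l k] l by (simp add: P_def)
    then have "P * fact (k + l) = fact l * fact k"
      by (simp add: power2_eq_square)
    moreover have "(fact (k + k) :: real) = 2 * real k * fact (k + l)"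
      using l by (simp add: algebra_simps)
    moreover have "(fact k :: real) = real k * fact l"
      using l by simp
    ultimately show ?thesis
      by (simp add: power2_eq_square)
  qed
  ultimately show ?case by simp
next
  case (step N)
  have ins: "{1..Suc N} - {k} = insert (Suc N) ({1..N} - {k})"
    using step by auto
  have "real k ^ 2 < real (Suc N) ^ 2" using step by (intro power_strict_mono) auto
  then have ratio: "\<bar>real (Suc N) ^ 2 / (real (Suc N) ^ 2 - real k ^ 2)\<bar> =
      real (Suc N) ^ 2 / ((real (Suc N) - real k) * (real (Suc N) + real k))"
    by (simp add: abs_divide power2_eq_square algebra_simps)
  have nz: "real (Suc N) - real k \<noteq> 0" "real (Suc N) + real k \<noteq> 0"
    using step by auto
  have "Suc N - k = Suc (N - k)" using step by auto
  then have 1: "(fact (Suc N - k) :: real) = (real (Suc N) - real k) * fact (N - k)"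
    using step by (simp only: fact_Suc) (simp add: of_nat_diff)
  have 2: "(fact (Suc N + k) :: real) = (real (Suc N) + real k) * fact (N + k)"
    by simp
  define P where "P = (\<Prod>j\<in>{1..N} - {k}. \<bar>real j ^ 2 / (real j ^ 2 - real k ^ 2)\<bar>)"
  have "(\<Prod>j\<in>{1..Suc N} - {k}. \<bar>real j ^ 2 / (real j ^ 2 - real k ^ 2)\<bar>) * (fact (Suc N - k) * fact (Suc N + k))
      = real (Suc N) ^ 2 * (P * (fact (N - k) * fact (N + k)))"
  proof -
    have "(\<Prod>j\<in>{1..Suc N} - {k}. \<bar>real j ^ 2 / (real j ^ 2 - real k ^ 2)\<bar>) =
        real (Suc N) ^ 2 / ((real (Suc N) - real k) * (real (Suc N) + real k)) * P"
      unfolding ins P_def by (subst prod.insert) (use ratio in auto)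
    then show ?thesis unfolding 1 2 using nz by simp
  qed
  also have "\<dots> = 2 * fact (Suc N) ^ 2"
    using step by (simp add: P_def power_mult_distrib)
  finally show ?case .
qed

lemma fact_square_le_fact_mult:
  assumes "k \<le> N"
  shows "(fact N ^ 2 :: real) \<le> fact (N - k) * fact (N + k)"
  using assms
proof (induction k)
  case (Suc k)
  have "N - k = Suc (N - Suc k)" using Suc by auto
  then have "(fact (N - k) :: real) = real (N - k) * fact (N - Suc k)"
    by (metis fact_Suc)
  moreover have "real (N - k) * (fact (N - Suc k) * fact (N + k)) \<le>
      real (N + Suc k) * (fact (N - Suc k) * fact (N + k))"
    by (intro mult_right_mono) auto
  ultimately have "fact (N - k) * fact (N + k) \<le> fact (N - Suc k) * (fact (N + Suc k) :: real)"
    by (simp add: mult_ac)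
  then show ?case using Suc.IH Suc.prems by linarith
qed (simp add: power2_eq_square)

text \<open>
  Split \<open>j\<^sup>4 - k\<^sup>4 = (j\<^sup>2 - k\<^sup>2) (j\<^sup>2 + k\<^sup>2)\<close>.  The factors \<open>j\<^sup>2 / (j\<^sup>2 - k\<^sup>2)\<close> multiply to
  \<open>2 N!\<^sup>2 / ((N - k)! (N + k)!)\<close> in absolute value, which is at most \<open>2\<close>.  Among the remaining
  factors \<open>j\<^sup>2 / (j\<^sup>2 + k\<^sup>2)\<close>, all at most \<open>1\<close>, those with \<open>j < k\<close> are at most \<open>1/2\<close>, and this
  is the source of the geometric decay.  The bound is uniform in \<open>N\<close>, so it survives the limit
  and dominates the passage to it.
\<close>

lemma abs_quartic_coeff_le: "\<bar>quartic_coeff N k\<bar> \<le> 4 * (1 / 2) ^ k"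
proof (cases "k \<in> {1..N}")
  case True
  have "\<bar>quartic_coeff N k\<bar> = (\<Prod>j\<in>{1..N} - {k}. \<bar>real j ^ 4 / (real j ^ 4 - real k ^ 4)\<bar>)"
    using True by (simp add: quartic_coeff_def abs_prod)
  also have "\<dots> = (\<Prod>j\<in>{1..N} - {k}. \<bar>real j ^ 2 / (real j ^ 2 - real k ^ 2)\<bar> * (real j ^ 2 / (real j ^ 2 + real k ^ 2)))"
  proof (intro prod.cong refl)
    fix j
    have "real j ^ 4 - real k ^ 4 = (real j ^ 2 - real k ^ 2) * (real j ^ 2 + real k ^ 2)"
      by algebra
    then have "real j ^ 4 / (real j ^ 4 - real k ^ 4) = real j ^ 2 / (real j ^ 2 - real k ^ 2) * (real j ^ 2 / (real j ^ 2 + real k ^ 2))"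
      by (simp flip: power_add)
    then show "\<bar>real j ^ 4 / (real j ^ 4 - real k ^ 4)\<bar> = \<bar>real j ^ 2 / (real j ^ 2 - real k ^ 2)\<bar> * (real j ^ 2 / (real j ^ 2 + real k ^ 2))"
      by (simp only: abs_mult abs_of_nonneg[of "real j ^ 2 / (real j ^ 2 + real k ^ 2)"] divide_nonneg_nonneg zero_le_power2 add_nonneg_nonneg)
  qed
  also have "\<dots> = (\<Prod>j\<in>{1..N} - {k}. \<bar>real j ^ 2 / (real j ^ 2 - real k ^ 2)\<bar>) * (\<Prod>j\<in>{1..N} - {k}. real j ^ 2 / (real j ^ 2 + real k ^ 2))"
    by (rule prod.distrib)
  also have "\<dots> \<le> 2 * (1 / 2) ^ (k - 1)"
  proof (rule mult_mono)
    show "(\<Prod>j\<in>{1..N} - {k}. \<bar>real j ^ 2 / (real j ^ 2 - real k ^ 2)\<bar>) \<le> 2"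
    proof -
      have "(fact N ^ 2 :: real) \<le> fact (N - k) * fact (N + k)"
        using True by (intro fact_square_le_fact_mult) auto
      then have "(\<Prod>j\<in>{1..N} - {k}. \<bar>real j ^ 2 / (real j ^ 2 - real k ^ 2)\<bar>) * (fact (N - k) * fact (N + k))
        \<le> 2 * (fact (N - k) * fact (N + k))"
        using prod_square_ratio[of k N] True by simp
      then show ?thesis by simp
    qed
    have pos: "0 < real j ^ 2 + real k ^ 2" for j
      using True by (intro add_nonneg_pos) auto
    have sub: "{1..<k} \<subseteq> {1..N} - {k}" using True by auto
    have "(\<Prod>j\<in>{1..N} - {k}. real j ^ 2 / (real j ^ 2 + real k ^ 2)) = 
       (\<Prod>j\<in>({1..N} - {k}) - {1..<k}. real j ^ 2 / (real j ^ 2 + real k ^ 2)) * (\<Prod>j\<in>{1..<k}. real j ^ 2 / (real j ^ 2 + real k ^ 2))"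
      using sub by (intro prod.subset_diff) auto
    also have "\<dots> \<le> 1 * (\<Prod>j\<in>{1..<k}. 1 / 2)"
    proof (intro mult_mono prod_mono prod_le_1 conjI)
      fix j assume j: "j \<in> {1..<k}"
      have "real j ^ 2 \<le> real k ^ 2" using j by (intro power_mono) auto
      then show "real j ^ 2 / (real j ^ 2 + real k ^ 2) \<le> 1 / 2"
        using pos[of j] by (simp add: divide_le_eq)
    qed (use pos in \<open>auto intro!: prod_nonneg simp: divide_le_eq_1\<close>)
    finally show "(\<Prod>j\<in>{1..N} - {k}. real j ^ 2 / (real j ^ 2 + real k ^ 2)) \<le> (1 / 2) ^ (k - 1)"
      by simp
  qed (auto intro: prod_nonneg)
  also have "\<dots> = 4 * (1 / 2) ^ k"
    using True by (cases k) auto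
  finally show ?thesis .
qed (auto simp: quartic_coeff_def)

text \<open>
  Once \<open>N \<ge> k\<close>, each new node multiplies the coefficient by a factor of at least \<open>1\<close>, so the
  sign is constant and the absolute value increases; it is bounded by the previous lemma.
\<close>

lemma convergent_quartic_coeff: "convergent (\<lambda>N. quartic_coeff N k)"
proof (cases "k = 0")
  case True then show ?thesis by (simp add: quartic_coeff_def convergent_const)
next
  case False
  \<comment> \<open>the common sign of the coefficients from \<open>N = k\<close> on\<close>
  define s :: real where "s = sgn (quartic_coeff k k)"
  have step: "quartic_coeff (Suc N) k = quartic_coeff N k * (real (Suc N) ^ 4 / (real (Suc N) ^ 4 - real k ^ 4))"
    if "k \<le> N" for N
  proof -
    have "{1..Suc N} - {k} = insert (Suc N) ({1..N} - {k})" using that by auto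
    then show ?thesis using that False by (simp add: quartic_coeff_def)
  qed
  have ge1: "1 \<le> real (Suc N) ^ 4 / (real (Suc N) ^ 4 - real k ^ 4)" if "k \<le> N" for N
  proof -
    have "real k ^ 4 < real (Suc N) ^ 4" using that by (intro power_strict_mono) auto
    then show ?thesis by (simp add: field_simps)
  qed
  have mono: "0 \<le> s * quartic_coeff (N + k) k \<and> s * quartic_coeff (N + k) k \<le> s * quartic_coeff (Suc N + k) k" for N
  proof -
    have nn: "0 \<le> s * quartic_coeff (N + k) k" for N
    proof (induction N)
      case 0 show ?case by (simp add: s_def sgn_mult_abs mult.commute abs_sgn[symmetric])
    next
      case (Suc N)
      show ?case using mult_nonneg_nonneg[OF Suc, of "real (Suc (N+k)) ^ 4 / (real (Suc (N+k)) ^ 4 - real k ^ 4)"] ge1[of "N+k"] step[of "N+k"]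
        by (simp add: mult.assoc)
    qed
    show ?thesis
      using mult_left_mono[OF ge1[of "N+k"] nn[of N]] step[of "N+k"] nn[of N] by (simp add: mult.assoc)
  qed
  have "incseq (\<lambda>N. s * quartic_coeff (N + k) k)"
    using mono by (intro incseq_SucI) auto
  moreover have "s * quartic_coeff (N + k) k \<le> 4 * (1/2) ^ k" for N
  proof -
    have "\<bar>s * quartic_coeff (N + k) k\<bar> \<le> 1 * (4 * (1/2) ^ k)"
      unfolding abs_mult using abs_quartic_coeff_le by (intro mult_mono) (auto simp: s_def sgn_if)
    then show ?thesis by simp
  qed
  ultimately have "convergent (\<lambda>N. s * quartic_coeff (N + k) k)"
    by (metis incseq_convergent convergentI)
  moreover have "s \<noteq> 0"
  proof -
    have "quartic_coeff k k \<noteq> 0"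
      using False by (auto simp: quartic_coeff_def power_eq_iff_eq_base)
    then show ?thesis by (simp add: s_def sgn_zero_iff)
  qed
  ultimately have "convergent (\<lambda>N. quartic_coeff (N + k) k)"
    by (simp add: convergent_mult_const_iff)
  then show ?thesis by (subst (asm) convergent_ignore_initial_segment)
qed

section \<open>Coefficients with vanishing fourth-power moments\<close>

text \<open>
  By the product formulas for \<open>sin\<close> and \<open>sinh\<close> the limit is
  \<open>4 (-1)\<^sup>k\<^sup>-\<^sup>1 \<pi> k / sinh (\<pi> k)\<close> for \<open>k \<ge> 1\<close>, but existence and decay are all that
  the argument relies on.
\<close>

definition flat_coeff :: "nat \<Rightarrow> real" where
  "flat_coeff k = lim (\<lambda>N. quartic_coeff N k)"

lemma quartic_coeff_tendsto: "(\<lambda>N. quartic_coeff N k) \<longlonglongrightarrow> flat_coeff k"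
  unfolding flat_coeff_def using convergent_quartic_coeff by (simp add: convergent_LIMSEQ_iff)

lemma abs_flat_coeff_le: "\<bar>flat_coeff k\<bar> \<le> 4 * (1 / 2) ^ k"
  by (rule tendsto_upperbound[OF tendsto_rabs[OF quartic_coeff_tendsto]])
     (auto intro: always_eventually abs_quartic_coeff_le)

lemma flat_coeff_0 [simp]: "flat_coeff 0 = 0"
  using LIMSEQ_unique[OF quartic_coeff_tendsto[of 0], of 0] by (simp add: quartic_coeff_def)

text \<open>
  One term \<open>x\<^sup>n / n!\<close> of the exponential series at \<open>x = k ln 2 / 2\<close> is at most
  \<open>exp x = (sqrt 2)\<^sup>k\<close>.  So half of the decay \<open>2\<^sup>-\<^sup>k\<close> absorbs the power of \<open>k\<close> at the price of a
  factorial, and the other half keeps the series in \<open>k\<close> convergent.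
\<close>

lemma power_times_half_power_le:
  "real k ^ n * (1 / 2) ^ k \<le> fact n / (ln 2 / 2) ^ n * (1 / sqrt 2) ^ k"
proof -
  define s :: real where "s = ln 2 / 2"
  have s: "s > 0" by (simp add: s_def)
  have "(real k * s) ^ n / fact n \<le> exp (real k * s)"
  proof -
    have "(real k * s) ^ n /\<^sub>R fact n \<le> (\<Sum>i. (real k * s) ^ i /\<^sub>R fact i)"
      using sum_le_suminf[OF summable_exp_generic[of "real k * s"], of "{n}"] s by auto
    then show ?thesis by (simp add: exp_def divide_inverse mult.commute)
  qed
  also have "exp (real k * s) = sqrt 2 ^ k"
  proof -
    have "exp s = sqrt 2"
      unfolding s_def by (simp add: ln_sqrt[symmetric])
    then show ?thesis by (simp add: exp_of_nat_mult)
  qed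
  finally have "real k ^ n * s ^ n \<le> fact n * sqrt 2 ^ k"
    by (simp add: divide_le_eq power_mult_distrib mult.commute)
  then have "real k ^ n \<le> fact n / s ^ n * sqrt 2 ^ k"
    using s by (simp add: field_simps)
  then have "real k ^ n * (1 / 2) ^ k \<le> fact n / s ^ n * sqrt 2 ^ k * (1 / 2) ^ k"
    by (intro mult_right_mono) auto
  also have "\<dots> = fact n / s ^ n * (sqrt 2 * (1 / 2)) ^ k"
    by (simp only: power_mult_distrib mult.assoc)
  also have "sqrt 2 * (1 / 2) = 1 / sqrt 2"
    by (simp add: real_divide_square_eq field_simps)
  finally show ?thesis by (simp add: s_def)
qed

lemma summable_inverse_sqrt_2_power: "summable (\<lambda>k. (1 / sqrt 2) ^ k :: real)"
  by (intro summable_geometric) simp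

lemma summable_power_times_half_power: "summable (\<lambda>k. real k ^ n * (1 / 2) ^ k)"
  by (rule summable_comparison_test'[OF summable_mult[OF summable_inverse_sqrt_2_power], of 0
        _ "fact n / (ln 2 / 2) ^ n"])
     (use power_times_half_power_le[of _ n] in auto)

text \<open>
  The interpolation identities hold for every \<open>N > m\<close>; Tannery's theorem carries them to the limit.
\<close>

lemma flat_coeff_moments:
  "(\<lambda>k. flat_coeff k * real k ^ (4 * m)) sums (if m = 0 then 1 else 0)"
proof -
  define M where "M = (\<lambda>k. 4 * (real k ^ (4 * m) * (1 / 2) ^ k))"
  have "summable M"
    unfolding M_def by (intro summable_mult summable_power_times_half_power)
  have bd: "norm (quartic_coeff N k * real k ^ (4 * m)) \<le> M k" for N k
    using mult_right_mono[OF abs_quartic_coeff_le[of N k], of "real k ^ (4 * m)"]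
    by (simp add: M_def abs_mult mult_ac)
  have T: "summable (\<lambda>k. norm (flat_coeff k * real k ^ (4 * m)))"
     "((\<lambda>N. \<Sum>k. quartic_coeff N k * real k ^ (4 * m)) \<longlongrightarrow> (\<Sum>k. flat_coeff k * real k ^ (4 * m))) sequentially"
    using tannerys_theorem[where a = "\<lambda>k N. quartic_coeff N k * real k ^ (4 * m)"
        and b = "\<lambda>k. flat_coeff k * real k ^ (4 * m)" and F = sequentially and M = M]
      \<open>summable M\<close> bd tendsto_mult[OF quartic_coeff_tendsto tendsto_const]
    by (auto intro: always_eventually)
  have "(\<Sum>k. quartic_coeff N k * real k ^ (4 * m)) = (if m = 0 then 1 else 0)" if "m < N" for N
  proof -
    have "(\<Sum>k. quartic_coeff N k * real k ^ (4 * m)) = (\<Sum>k\<in>{1..N}. quartic_coeff N k * real k ^ (4 * m))"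
      by (intro suminf_finite) (auto simp: quartic_coeff_def)
    then show ?thesis using sum_quartic_coeff_powers[OF that] by simp
  qed
  then have "eventually (\<lambda>N. (\<Sum>k. quartic_coeff N k * real k ^ (4 * m)) = (if m = 0 then 1 else 0)) sequentially"
    by (intro eventually_mono[OF eventually_gt_at_top[of m]])
  then have "((\<lambda>N. \<Sum>k. quartic_coeff N k * real k ^ (4 * m)) \<longlongrightarrow> (if m = 0 then 1 else 0)) sequentially"
    by (rule tendsto_eventually)
  then have "(\<Sum>k. flat_coeff k * real k ^ (4 * m)) = (if m = 0 then 1 else 0)"
    using T(2) by (blast intro: LIMSEQ_unique)
  moreover have "summable (\<lambda>k. flat_coeff k * real k ^ (4 * m))"
    using T(1) by (rule summable_norm_cancel)
  ultimately show ?thesis by (simp add: sums_iff)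
qed

section \<open>A lacunary cosine series that is exponentially flat at zero\<close>

definition flat_fun :: "real \<Rightarrow> real" where
  "flat_fun t = 1 - (\<Sum>k. flat_coeff k * cos (2 * pi * real k ^ 2 * t))"

lemma abs_flat_term_le: "\<bar>flat_coeff k * cos x\<bar> \<le> 4 * (1 / 2) ^ k"
  using mult_mono[OF abs_flat_coeff_le abs_cos_le_one] by (simp add: abs_mult)

lemma summable_flat_terms: "summable (\<lambda>k. \<bar>flat_coeff k * cos (x k)\<bar>)"
  by (rule summable_comparison_test'[of "\<lambda>k. 4 * (1 / 2) ^ k" 0])
     (use abs_flat_term_le in \<open>auto intro: summable_mult summable_geometric\<close>)

text \<open>
  Insert the Taylor polynomial of order \<open>n\<close> of the cosine into every term of the series.  The
  coefficient of \<open>t\<^sup>m\<close> is then a moment: it vanishes for odd \<open>m\<close> because the cosine is even and for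
  even \<open>m > 0\<close> by \<open>flat_coeff_moments\<close>, and for \<open>m = 0\<close> it cancels the leading \<open>1\<close>.  Only the Lagrange remainders
  survive.
\<close>

lemma flat_fun_Taylor:
  assumes "n > 0"
  shows "\<bar>flat_fun t\<bar> \<le> (\<Sum>k. \<bar>flat_coeff k\<bar> * (2 * pi * real k ^ 2 * \<bar>t\<bar>) ^ n / fact n)"
    and "summable (\<lambda>k. \<bar>flat_coeff k\<bar> * (2 * pi * real k ^ 2 * \<bar>t\<bar>) ^ n / fact n)"
proof -
  define x where "x = (\<lambda>k. 2 * pi * real k ^ 2 * t)"
  define T where "T = (\<lambda>k. \<Sum>m<n. cos_coeff m * x k ^ m)"
  have rem: "\<bar>cos (x k) - T k\<bar> \<le> (2 * pi * real k ^ 2 * \<bar>t\<bar>) ^ n / fact n" for k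
  proof -
    obtain u where "cos (x k) = T k + (cos (u + 1/2 * real n * pi) / fact n) * x k ^ n"
      unfolding T_def using Maclaurin_cos_expansion[of "x k" n] by blast
    then have "\<bar>cos (x k) - T k\<bar> = \<bar>cos (u + 1/2 * real n * pi)\<bar> * \<bar>x k\<bar> ^ n / fact n"
      by (simp add: abs_mult power_abs)
    also have "\<dots> \<le> 1 * \<bar>x k\<bar> ^ n / fact n"
      by (intro divide_right_mono mult_right_mono) auto
    finally show ?thesis by (simp add: x_def abs_mult)
  qed
  have "(\<lambda>k. flat_coeff k * T k) sums (\<Sum>m<n. cos_coeff m * (2 * pi * t) ^ m * (if m = 0 then 1 else 0))"
  proof -
    have "(\<lambda>k. cos_coeff m * (2 * pi * t) ^ m * (flat_coeff k * real k ^ (2 * m))) sums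
        (cos_coeff m * (2 * pi * t) ^ m * (if m = 0 then 1 else 0))" for m
    proof (cases "even m")
      case True
      then obtain i where "m = 2 * i" by auto
      then show ?thesis using sums_mult[OF flat_coeff_moments[of i]] by auto
    next
      case False
      then show ?thesis by (simp add: cos_coeff_def)
    qed
    then have "(\<lambda>k. \<Sum>m<n. cos_coeff m * (2 * pi * t) ^ m * (flat_coeff k * real k ^ (2 * m))) sums
        (\<Sum>m<n. cos_coeff m * (2 * pi * t) ^ m * (if m = 0 then 1 else 0))"
      by (rule sums_sum)
    moreover have "(\<Sum>m<n. cos_coeff m * (2 * pi * t) ^ m * (flat_coeff k * real k ^ (2 * m))) = flat_coeff k * T k" for k
      unfolding T_def x_def sum_distrib_left power_mult
      by (intro sum.cong) (auto simp: power_mult_distrib mult_ac)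
    ultimately show ?thesis by simp
  qed
  also have "(\<Sum>m<n. cos_coeff m * (2 * pi * t) ^ m * (if m = 0 then 1 else 0)) = 1"
    using assms by (simp add: if_distrib[of "\<lambda>c. _ * c"] cong: if_cong)
  finally have 1: "(\<lambda>k. flat_coeff k * T k) sums 1" .
  have 2: "(\<lambda>k. flat_coeff k * cos (x k)) sums (1 - flat_fun t)"
    using summable_rabs_cancel[OF summable_flat_terms[of x]] by (simp add: flat_fun_def x_def sums_iff)
  have F: "(\<lambda>k. flat_coeff k * (cos (x k) - T k)) sums (- flat_fun t)"
    using sums_diff[OF 2 1] by (simp add: algebra_simps)
  have bd: "norm (flat_coeff k * (cos (x k) - T k)) \<le> \<bar>flat_coeff k\<bar> * (2 * pi * real k ^ 2 * \<bar>t\<bar>) ^ n / fact n" for k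
    using mult_left_mono[OF rem[of k], of "\<bar>flat_coeff k\<bar>"] by (simp add: abs_mult)
  show S: "summable (\<lambda>k. \<bar>flat_coeff k\<bar> * (2 * pi * real k ^ 2 * \<bar>t\<bar>) ^ n / fact n)"
  proof (rule summable_comparison_test'[of _ 0])
    show "summable (\<lambda>k. 4 * (2 * pi * \<bar>t\<bar>) ^ n / fact n * (real k ^ (2 * n) * (1 / 2) ^ k))"
      by (intro summable_mult summable_power_times_half_power)
    fix k :: nat
    have "\<bar>flat_coeff k\<bar> * ((2 * pi * real k ^ 2 * \<bar>t\<bar>) ^ n / fact n) \<le> 4 * (1 / 2) ^ k * ((2 * pi * real k ^ 2 * \<bar>t\<bar>) ^ n / fact n)"
      by (intro mult_right_mono abs_flat_coeff_le) auto
    then show "norm (\<bar>flat_coeff k\<bar> * (2 * pi * real k ^ 2 * \<bar>t\<bar>) ^ n / fact n)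
        \<le> 4 * (2 * pi * \<bar>t\<bar>) ^ n / fact n * (real k ^ (2 * n) * (1 / 2) ^ k)"
      unfolding power_mult by (simp add: power_mult_distrib abs_mult mult_ac)
  qed
  have "norm (\<Sum>k. flat_coeff k * (cos (x k) - T k)) \<le> (\<Sum>k. \<bar>flat_coeff k\<bar> * (2 * pi * real k ^ 2 * \<bar>t\<bar>) ^ n / fact n)"
    by (rule norm_suminf_le[OF bd S])
  then show "\<bar>flat_fun t\<bar> \<le> (\<Sum>k. \<bar>flat_coeff k\<bar> * (2 * pi * real k ^ 2 * \<bar>t\<bar>) ^ n / fact n)"
    using F by (simp add: sums_iff)
qed

text \<open>
  The factorials \<open>(2 n)!\<close> from the moments of \<open>2\<^sup>-\<^sup>k\<close> and \<open>n!\<close> from Taylor's formula combine to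
  \<open>(2 n)! / n! \<le> (2 n)\<^sup>n\<close>.
\<close>

lemma flat_fun_power_bound:
  obtains A K where "A > 0" "K > 0" "\<And>n t. t \<ge> 0 \<Longrightarrow> \<bar>flat_fun t\<bar> \<le> K * (A * real n * t) ^ n"
proof -
  define s :: real where "s = ln 2 / 2"
  have s: "s > 0" by (simp add: s_def)
  define A where "A = 4 * pi / s ^ 2"
  define G where "G = (\<Sum>k. (1 / sqrt 2) ^ k :: real)"
  \<comment> \<open>\<open>9\<close> bounds \<open>flat_fun\<close> itself, which is the case \<open>n = 0\<close>\<close>
  define K where "K = 9 + 4 * G"
  have "G \<ge> 0" unfolding G_def by (intro suminf_nonneg summable_inverse_sqrt_2_power) auto
  have "\<bar>flat_fun t\<bar> \<le> K * (A * real n * t) ^ n" if "t \<ge> 0" for n t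
  proof (cases "n = 0")
    case True
    have "\<bar>\<Sum>k. flat_coeff k * cos (2 * pi * real k ^ 2 * t)\<bar> \<le> (\<Sum>k. 4 * (1 / 2) ^ k)"
      using norm_suminf_le[of "\<lambda>k. flat_coeff k * cos (2 * pi * real k ^ 2 * t)" "\<lambda>k. 4 * (1 / 2) ^ k"]
        abs_flat_term_le by (simp add: summable_geometric)
    also have "\<dots> = 8"
      by (simp add: suminf_mult suminf_geometric summable_geometric)
    finally show ?thesis
      using True \<open>G \<ge> 0\<close> by (simp add: flat_fun_def K_def)
  next
    case False
    have "\<bar>flat_fun t\<bar> \<le> (\<Sum>k. \<bar>flat_coeff k\<bar> * (2 * pi * real k ^ 2 * t) ^ n / fact n)"
      using flat_fun_Taylor(1)[of n t] False that by simp
    also have "\<dots> \<le> (\<Sum>k. 4 * (A * real n * t) ^ n * (1 / sqrt 2) ^ k)"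
    proof (rule suminf_le)
      fix k
      have fact_bound: "(fact (2 * n) / fact n :: real) \<le> (2 * real n) ^ n"
      proof -
        have "fact (2 * n) div fact (2 * n - n) \<le> (2 * n) ^ n"
          by (rule fact_div_fact_le_pow) simp
        then have "real (fact (2 * n) div fact n) \<le> real ((2 * n) ^ n)"
          by (intro of_nat_mono) simp
        moreover have "(fact n :: nat) dvd fact (2 * n)"
          by (intro fact_dvd) simp
        ultimately show ?thesis
          by (simp add: real_of_nat_div)
      qed
      have "\<bar>flat_coeff k\<bar> * (2 * pi * real k ^ 2 * t) ^ n / fact n \<le> 4 * (1 / 2) ^ k * (2 * pi * real k ^ 2 * t) ^ n / fact n"
        using that by (intro divide_right_mono mult_right_mono abs_flat_coeff_le) auto
      also have "\<dots> = 4 * (2 * pi * t) ^ n / fact n * (real k ^ (2 * n) * (1 / 2) ^ k)"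
        unfolding power_mult by (simp add: power_mult_distrib mult_ac)
      also have "\<dots> \<le> 4 * (2 * pi * t) ^ n / fact n * (fact (2 * n) / s ^ (2 * n) * (1 / sqrt 2) ^ k)"
        unfolding s_def using that by (intro mult_left_mono power_times_half_power_le) auto
      also have "\<dots> = (fact (2 * n) / fact n) * (4 * (2 * pi * t) ^ n / s ^ (2 * n) * (1 / sqrt 2) ^ k)"
        by simp
      also have "\<dots> \<le> (2 * real n) ^ n * (4 * (2 * pi * t) ^ n / s ^ (2 * n) * (1 / sqrt 2) ^ k)"
        using that s by (intro mult_right_mono fact_bound) auto
      also have "\<dots> = 4 * (2 * real n * (2 * pi * t) / s ^ 2) ^ n * (1 / sqrt 2) ^ k"
      proof -
        have "(4 :: real) ^ n = 2 ^ n * 2 ^ n"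
          by (simp flip: power_mult_distrib)
        then show ?thesis
          unfolding power_mult by (simp add: power_mult_distrib power_divide mult_ac)
      qed
      also have "2 * real n * (2 * pi * t) / s ^ 2 = A * real n * t"
        by (simp add: A_def)
      finally show "\<bar>flat_coeff k\<bar> * (2 * pi * real k ^ 2 * t) ^ n / fact n \<le> 4 * (A * real n * t) ^ n * (1 / sqrt 2) ^ k" .
    qed (use flat_fun_Taylor(2)[of n t] False that in \<open>auto intro!: summable_mult summable_inverse_sqrt_2_power\<close>)
    also have "\<dots> = 4 * G * (A * real n * t) ^ n"
      unfolding G_def by (subst suminf_mult[OF summable_inverse_sqrt_2_power]) simp
    also have "\<dots> \<le> K * (A * real n * t) ^ n"
      using that s by (intro mult_right_mono) (auto simp: K_def A_def)
    finally show ?thesis .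
  qed
  moreover have "A > 0" using s by (simp add: A_def)
  moreover have "K > 0" using \<open>G \<ge> 0\<close> by (simp add: K_def)
  ultimately show ?thesis using that by blast
qed

text \<open>
  Optimise the order \<open>n\<close>: with \<open>n\<close> close to \<open>1 / (2 A t)\<close> the base \<open>A n t\<close> is at most \<open>1/2\<close>,
  and \<open>(1/2)\<^sup>n\<close> is exponentially small in \<open>1 / t\<close>.
\<close>

lemma flat_fun_exp_bound:
  obtains C d where "C > 0" "d > 0" "\<And>t. t \<ge> 0 \<Longrightarrow> \<bar>flat_fun t\<bar> \<le> C * exp (- d / t)"
proof -
  obtain A K where AK: "A > 0" "K > 0" and bd: "\<And>n t. t \<ge> 0 \<Longrightarrow> \<bar>flat_fun t\<bar> \<le> K * (A * real n * t) ^ n"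
    using flat_fun_power_bound by blast
  define d where "d = ln 2 / (2 * A)"
  have "d > 0" using AK by (simp add: d_def)
  have "\<bar>flat_fun t\<bar> \<le> 2 * K * exp (- d / t)" if "t \<ge> 0" for t
  proof (cases "t = 0")
    case True
    then show ?thesis using bd[of t 1] AK by simp
  next
    case False
    then have t: "t > 0" using that by simp
    \<comment> \<open>the real number for which \<open>A y t = 1/2\<close>; the order used is its integer part\<close>
    define y where "y = 1 / (2 * A * t)"
    have y: "y > 0" using t AK by (simp add: y_def)
    define n where "n = nat \<lfloor>y\<rfloor>"
    have n: "real n \<le> y" "y \<le> real n + 1"
      using y by (auto simp: n_def intro: of_nat_floor)
    have "A * real n * t \<le> A * y * t"
      using n AK t by (intro mult_right_mono mult_left_mono) auto
    also have "\<dots> = 1 / 2" using AK t by (simp add: y_def)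
    finally have "(A * real n * t) ^ n \<le> (1 / 2) ^ n"
      using AK t by (intro power_mono) auto
    also have "(1 / 2 :: real) ^ n = exp (- ln 2 * real n)"
      by (simp add: exp_minus exp_of_nat2_mult power_one_over inverse_eq_divide)
    also have "\<dots> \<le> exp (ln 2 + - ln 2 * y)"
    proof -
      have "ln 2 * y \<le> ln 2 * (real n + 1)" using n by (intro mult_left_mono) auto
      then show ?thesis by (simp add: algebra_simps)
    qed
    also have "\<dots> = 2 * exp (- d / t)"
      unfolding exp_add by (simp add: y_def d_def)
    finally have "K * (A * real n * t) ^ n \<le> K * (2 * exp (- d / t))"
      using AK by (intro mult_left_mono) auto
    then show ?thesis using bd[OF that, of n] by simp
  qed
  then show ?thesis using that[of "2 * K" d] \<open>d > 0\<close> AK by simp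
qed

section \<open>Orthogonality to the characters of non-square frequency\<close>

definition exponential :: "int \<Rightarrow> real \<Rightarrow> complex" where
  "exponential n t = exp (2 * of_real pi * \<i> * of_int n * of_real t)"

abbreviation circle :: "real measure" where "circle \<equiv> lebesgue_on {0..1}"

lemma continuous_on_exponential [continuous_intros]: "continuous_on S (exponential n)"
  unfolding exponential_def by (intro continuous_intros)

lemma norm_exponential [simp]: "cmod (exponential n t) = 1"
  by (simp add: exponential_def)

lemma integrable_exponential [simp]: "integrable circle (exponential n)"
  by (intro continuous_imp_integrable_real continuous_intros)

lemma measure_circle [simp]: "measure circle {0..1} = 1" "emeasure circle {0..1} = 1"
  by (simp_all add: measure_restrict_space emeasure_restrict_space)

lemma integral_exponential: "integral\<^sup>L circle (exponential n) = (if n = 0 then 1 else 0)"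
proof (cases "n = 0")
  case True
  then have "exponential n = (\<lambda>_. 1)" by (auto simp: exponential_def)
  then show ?thesis using True by simp
next
  case False
  define c :: complex where "c = 2 * of_real pi * \<i> * of_int n"
  have c: "c \<noteq> 0" using False by (simp add: c_def)
  have "(exponential n has_integral (exp (c * of_real 1) / c - exp (c * of_real 0) / c)) {0..1}"
  proof (rule fundamental_theorem_of_calculus)
    fix t :: real
    have "((\<lambda>z. exp (c * z) / c) has_field_derivative exp (c * of_real t)) (at (of_real t))"
      using c by (auto intro!: derivative_eq_intros)
    then have "((\<lambda>t. exp (c * of_real t) / c) has_vector_derivative exp (c * of_real t)) (at t within {0..1})"
      by (rule has_vector_derivative_real_field)
    then show "((\<lambda>t. exp (c * of_real t) / c) has_vector_derivative exponential n t) (at t within {0..1})"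
      by (simp add: exponential_def c_def)
  qed simp
  moreover have "exp c = 1"
    unfolding exp_eq_1 c_def by (auto intro: exI[of _ n])
  ultimately have "(exponential n has_integral 0) {0..1}" by simp
  then show ?thesis
    using False lebesgue_integral_eq_integral[OF integrable_exponential[of n]] by (simp add: integral_unique)
qed

lemma cos_times_exponential:
  "of_real (cos (2 * pi * real k ^ 2 * t)) * exponential n t =
     (exponential (n + int k ^ 2) t + exponential (n - int k ^ 2) t) / 2"
proof -
  have "complex_of_real (cos (2 * pi * real k ^ 2 * t)) = (exp (\<i> * of_real (2 * pi * real k ^ 2 * t)) + exp (- (\<i> * of_real (2 * pi * real k ^ 2 * t)))) / 2"
    unfolding cos_of_real[symmetric] cos_exp_eq by (simp only: mult_minus_left)
  moreover have "exponential (n + int k ^ 2) t = exp (\<i> * of_real (2 * pi * real k ^ 2 * t)) * exponential n t"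
    unfolding exponential_def exp_add[symmetric] by (simp add: algebra_simps)
  moreover have "exponential (n - int k ^ 2) t = exp (- (\<i> * of_real (2 * pi * real k ^ 2 * t))) * exponential n t"
    unfolding exponential_def exp_add[symmetric] by (simp add: algebra_simps)
  ultimately show ?thesis
    by (simp only: distrib_right times_divide_eq_left)
qed

lemma flat_fun_measurable [measurable]: "flat_fun \<in> borel_measurable borel"
  unfolding flat_fun_def by measurable

lemma borel_measurable_circle: "f \<in> borel_measurable borel \<Longrightarrow> f \<in> borel_measurable circle"
  by (intro measurable_restrict_space1 measurable_completion) simp

text \<open>
  The frequencies of \<open>flat_fun\<close> are \<open>0\<close> and \<open>\<plusminus>k\<^sup>2\<close>, so multiplication by a character of
  nonnegative frequency \<open>n\<close> meets frequency \<open>0\<close> only when \<open>n\<close> is \<open>0\<close> or a square.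
\<close>

lemma integral_exponential_times_flat_fun:
  assumes n: "n \<ge> 0" and nonsquare: "\<And>k. k \<ge> 1 \<Longrightarrow> n \<noteq> int k ^ 2"
  shows "integral\<^sup>L circle (\<lambda>t. exponential n t * of_real (flat_fun t)) = (if n = 0 then 1 else 0)"
proof -
  define f where "f = (\<lambda>k t. of_real (flat_coeff k) * (of_real (cos (2 * pi * real k ^ 2 * t)) * exponential n t))"
  have norm_f: "norm (f k t) \<le> 4 * (1 / 2) ^ k" for k t
    using abs_flat_term_le[of k "2 * pi * real k ^ 2 * t"] by (simp add: f_def norm_mult abs_mult)
  have int_f: "integrable circle (f k)" for k
    unfolding f_def cos_times_exponential by (intro integrable_mult_right integrable_divide_zero integrable_add) auto
  have "integral\<^sup>L circle (f k) = 0" for k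
  proof (cases "k = 0")
    case True
    then show ?thesis by (simp add: f_def)
  next
    case False
    then have "n + int k ^ 2 \<noteq> 0" "n - int k ^ 2 \<noteq> 0"
      using n nonsquare[of k] by (auto simp: add_nonneg_eq_0_iff)
    then show ?thesis
      unfolding f_def cos_times_exponential by (simp add: integral_exponential)
  qed
  moreover have geo: "summable (\<lambda>k. 4 * (1 / 2) ^ k :: real)"
    by (intro summable_mult summable_geometric) simp
  have AE: "AE t in circle. summable (\<lambda>k. norm (f k t))"
    using norm_f by (intro AE_I2 summable_comparison_test'[OF geo, of 0]) auto
  have S: "summable (\<lambda>k. \<integral>t. norm (f k t) \<partial>circle)"
  proof (rule summable_comparison_test'[OF geo, of 0])
    fix k
    have "(\<integral>t. norm (f k t) \<partial>circle) \<le> (\<integral>t. 4 * (1 / 2) ^ k \<partial>circle)"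
      using norm_f int_f by (intro integral_mono) auto
    then show "norm (\<integral>t. norm (f k t) \<partial>circle) \<le> 4 * (1 / 2) ^ k"
      by simp
  qed
  ultimately have sum0: "integral\<^sup>L circle (\<lambda>t. \<Sum>k. f k t) = 0"
    using integral_suminf[OF int_f AE S] by simp
  have int: "integrable circle (\<lambda>t. \<Sum>k. f k t)"
    by (rule integrable_suminf[OF int_f AE S])
  have eq: "exponential n t * of_real (flat_fun t) = exponential n t - (\<Sum>k. f k t)" for t
  proof -
    have s: "summable (\<lambda>k. flat_coeff k * cos (2 * pi * real k ^ 2 * t))"
      by (rule summable_rabs_cancel[OF summable_flat_terms])
    have "(\<lambda>k. of_real (flat_coeff k * cos (2 * pi * real k ^ 2 * t)) * exponential n t) sums
       (of_real (\<Sum>k. flat_coeff k * cos (2 * pi * real k ^ 2 * t)) * exponential n t)"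
      by (intro sums_mult2 sums_of_real summable_sums s)
    then have "(\<Sum>k. f k t) = of_real (\<Sum>k. flat_coeff k * cos (2 * pi * real k ^ 2 * t)) * exponential n t"
      by (simp add: f_def sums_iff mult.assoc)
    then show ?thesis
      by (simp add: flat_fun_def algebra_simps)
  qed
  show "integral\<^sup>L circle (\<lambda>t. exponential n t * of_real (flat_fun t)) = (if n = 0 then 1 else 0)"
    unfolding eq using int sum0 by (simp add: integral_exponential)
qed

section \<open>The weight \<open>exp (- d / t)\<close>\<close>

text \<open>
  The part over \<open>{exp (- n)..1}\<close> already contributes \<open>d n\<close>.
\<close>

lemma nn_integral_inverse_circle:
  assumes "d > 0"
  shows "(\<integral>\<^sup>+ t. ennreal (d / t) \<partial>circle) = \<infinity>"
proof -
  have low: "ennreal (d * real n) \<le> (\<integral>\<^sup>+ t. ennreal (d / t) \<partial>circle)" for n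
  proof -
    define a where "a = exp (- real n)"
    have a: "0 < a" "a \<le> 1" by (auto simp: a_def)
    have "(\<integral>\<^sup>+ t. ennreal (d / t) * indicator {a..1} t \<partial>lborel) = ennreal (d * ln 1 - d * ln a)"
    proof (rule nn_integral_FTC_Icc)
      show "((\<lambda>t. d * ln t) has_real_derivative d / x) (at x)" if "x \<in> {a..1}" for x
        using that a by (auto intro!: derivative_eq_intros)
    qed (use a assms in auto)
    then have "ennreal (d * real n) = (\<integral>\<^sup>+ t. ennreal (d / t) * indicator {a..1} t \<partial>lborel)"
      by (simp add: a_def)
    also have "\<dots> \<le> (\<integral>\<^sup>+ t. ennreal (d / t) * indicator {0..1} t \<partial>lborel)"
      using a by (intro nn_integral_mono) (auto split: split_indicator)
    also have "\<dots> = (\<integral>\<^sup>+ t. ennreal (d / t) * indicator {0..1} t \<partial>lebesgue)"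
      by (simp add: nn_integral_completion)
    also have "\<dots> = (\<integral>\<^sup>+ t. ennreal (d / t) \<partial>circle)"
      by (subst nn_integral_restrict_space) auto
    finally show ?thesis .
  qed
  show ?thesis
  proof (rule ccontr)
    assume "\<not> ?thesis"
    then obtain r where r: "r \<ge> 0" "(\<integral>\<^sup>+ t. ennreal (d / t) \<partial>circle) = ennreal r"
      by (cases "\<integral>\<^sup>+ t. ennreal (d / t) \<partial>circle") auto
    obtain n where "r < real n * d" using reals_Archimedean3[OF assms] by blast
    then show False using low[of n] r assms by (simp add: ennreal_le_iff mult.commute)
  qed
qed

lemma is_weight_exp_neg_inverse:
  assumes "d > 0"
  shows "is_weight (\<lambda>t. exp (- d / t))"
proof -
  have "integrable circle (\<lambda>t. exp (- d / t))"
    by (rule Bochner_Integration.integrable_bound[of _ "\<lambda>_. 1 :: real"])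
       (use assms in \<open>auto intro!: borel_measurable_circle AE_I2\<close>)
  then show ?thesis by (simp add: is_weight_def)
qed

lemma condition_A_exp_neg_inverse:
  assumes "d > 0"
  shows "condition_A (\<lambda>t. exp (- d / t))"
  unfolding condition_A_def integral_eq_MInf_def
proof (intro conjI ballI)
  show "strict_mono_on {0<..<1} (\<lambda>t. exp (- d / t))"
    using assms by (auto simp: strict_mono_on_def divide_strict_left_mono)
  show "bounded ((\<lambda>t. exp (- d / t)) ` {0<..<1})"
    unfolding bounded_iff using assms by (intro exI[of _ 1]) auto
  show "(\<lambda>t. ln (exp (- d / t))) \<in> borel_measurable circle"
    by (auto intro!: borel_measurable_circle)
  have "(\<integral>\<^sup>+ t. ennreal (ln (exp (- d / t))) \<partial>circle) = (\<integral>\<^sup>+ t. 0 \<partial>circle)"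
    using assms by (intro nn_integral_cong) (auto intro: ennreal_neg)
  then show "(\<integral>\<^sup>+ t. ennreal (ln (exp (- d / t))) \<partial>circle) < \<infinity>" by simp
  show "(\<integral>\<^sup>+ t. ennreal (- ln (exp (- d / t))) \<partial>circle) = \<infinity>"
    using nn_integral_inverse_circle[OF assms] by simp
qed simp

section \<open>Incompleteness from an annihilating function\<close>

text \<open>
  The function \<open>g / w\<close> is bounded, and integrating against it with respect to the weight
  annihilates \<open>S\<close> but not the constant \<open>1\<close>; hence \<open>1\<close> is not in the closed span.  Instead of
  forming the quotient, the proof integrates \<open>(1 - p) g\<close> for an approximant \<open>p\<close> and
  estimates \<open>\<bar>1 - p\<bar> w\<close> by the inequality between arithmetic and geometric means.
\<close>

lemma not_spans_L2_if_annihilated: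
  fixes w g :: "real \<Rightarrow> real"
  assumes w: "w \<in> borel_measurable circle" "\<And>t. t \<in> {0..1} \<Longrightarrow> 0 \<le> w t \<and> w t \<le> 1"
    and g: "g \<in> borel_measurable circle" "\<And>t. t \<in> {0..1} \<Longrightarrow> \<bar>g t\<bar> \<le> C * w t"
    and S: "\<And>e. e \<in> S \<Longrightarrow> continuous_on {0..1} e"
    and annih: "\<And>e. e \<in> S \<Longrightarrow> integral\<^sup>L circle (\<lambda>t. e t * of_real (g t)) = 0"
    and nonzero: "integral\<^sup>L circle g \<noteq> 0"
  shows "\<not> spans_L2 S w"
proof
  assume spans: "spans_L2 S w"
  define I where "I = integral\<^sup>L circle g"
  have C: "C > 0"
  proof (rule ccontr)
    assume "\<not> C > 0"
    have "g t = 0" if "t \<in> {0..1}" for t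
      using g(2)[OF that] w(2)[OF that] mult_right_mono[of C 0 "w t"] \<open>\<not> C > 0\<close> by auto
    then have "integral\<^sup>L circle g = integral\<^sup>L circle (\<lambda>_. 0)"
      by (intro Bochner_Integration.integral_cong) auto
    then show False using nonzero by simp
  qed
  \<comment> \<open>with this choice the estimate \<open>\<bar>I\<bar> < C \<epsilon>\<close> obtained at the end is contradictory\<close>
  define \<epsilon> where "\<epsilon> = \<bar>I\<bar> / (2 * C)"
  have eps: "\<epsilon> > 0" using nonzero C by (simp add: \<epsilon>_def I_def)
  have "(\<lambda>_. 1) \<in> L2_space w"
  proof -
    have "L2_normsq w (\<lambda>_. 1) \<le> (\<integral>\<^sup>+ t. 1 \<partial>circle)"
      unfolding L2_normsq_def using w(2) by (intro nn_integral_mono) auto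
    also have "\<dots> = 1" using measure_circle by simp
    finally show ?thesis by (simp add: L2_space_def le_less_trans)
  qed
  then obtain p where p: "p \<in> finite_combinations S" "L2_normsq w (\<lambda>t. 1 - p t) < ennreal (\<epsilon>\<^sup>2)"
    using spans[unfolded spans_L2_def, THEN bspec, THEN spec, THEN mp, OF _ eps] by auto
  obtain F c where F: "finite F" "F \<subseteq> S" and p_eq: "p = (\<lambda>t. \<Sum>e\<in>F. c e * e t)"
    using p(1) unfolding finite_combinations_def by auto
  define h where "h = (\<lambda>t. 1 - p t)"
  have cont_h: "continuous_on {0..1} h"
    unfolding h_def p_eq using F S by (intro continuous_intros) auto
  have int_cont: "integrable circle (\<lambda>t. u t * of_real (v t))"
    if "continuous_on {0..1} u" "v \<in> borel_measurable circle" "\<And>t. t \<in> {0..1} \<Longrightarrow> \<bar>v t\<bar> \<le> B"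
    for u :: "real \<Rightarrow> complex" and v :: "real \<Rightarrow> real" and B
  proof (rule Bochner_Integration.integrable_bound)
    show iu: "integrable circle (\<lambda>t. of_real B * u t)"
      using that by (intro integrable_mult_right continuous_imp_integrable_real)
    have "integrable circle u" using that by (intro continuous_imp_integrable_real)
    then have "u \<in> borel_measurable circle" by (rule borel_measurable_integrable)
    with that show "(\<lambda>t. u t * of_real (v t)) \<in> borel_measurable circle" by measurable
    show "AE t in circle. norm (u t * of_real (v t)) \<le> norm (of_real B * u t)"
    proof (rule AE_I2)
      fix t assume "t \<in> space circle"
      then have "\<bar>v t\<bar> \<le> \<bar>B\<bar>" using that(3)[of t] by auto
      then have "cmod (u t) * \<bar>v t\<bar> \<le> cmod (u t) * \<bar>B\<bar>" by (rule mult_left_mono) simp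
      then show "norm (u t * of_real (v t)) \<le> norm (of_real B * u t)"
        by (simp add: norm_mult mult.commute)
    qed
  qed
  have g_le: "\<bar>g t\<bar> \<le> C" if "t \<in> {0..1}" for t
  proof -
    have "C * w t \<le> C * 1"
      using w(2)[OF that] C by (intro mult_left_mono) auto
    then show ?thesis using g(2)[OF that] by linarith
  qed
  have int_hg: "integrable circle (\<lambda>t. h t * of_real (g t))"
    by (rule int_cont[OF cont_h g(1) g_le])
  have "integral\<^sup>L circle (\<lambda>t. h t * of_real (g t)) = of_real I"
  proof -
    have int_e: "integrable circle (\<lambda>t. e t * of_real (g t))" if "e \<in> F" for e
      using that F S by (intro int_cont[OF _ g(1) g_le]) auto
    have "integral\<^sup>L circle (\<lambda>t. h t * of_real (g t)) =
       integral\<^sup>L circle (\<lambda>t. of_real (g t) - (\<Sum>e\<in>F. c e * (e t * of_real (g t))))"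
      by (simp add: h_def p_eq algebra_simps sum_distrib_left)
    also have "\<dots> = integral\<^sup>L circle (\<lambda>t. of_real (g t)) - (\<Sum>e\<in>F. c e * integral\<^sup>L circle (\<lambda>t. e t * of_real (g t)))"
      using int_e int_cont[of "\<lambda>_. 1", OF _ g(1) g_le] by (simp add: integral_sum)
    also have "\<dots> = of_real I"
      using F annih by (simp add: I_def subset_iff)
    finally show ?thesis .
  qed
  define q where "q = (\<lambda>t. (cmod (h t))\<^sup>2 * w t)"
  have int_q: "integrable circle q"
  proof -
    have "integrable circle (\<lambda>t. of_real ((cmod (h t))\<^sup>2) * complex_of_real (w t))"
      using w by (intro int_cont[of _ _ 1] continuous_intros cont_h) auto
    then have "integrable circle (\<lambda>t. complex_of_real (q t))" by (simp add: q_def)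
    then show ?thesis by (simp add: complex_of_real_integrable_eq)
  qed
  have "ennreal (integral\<^sup>L circle q) = L2_normsq w h"
    unfolding L2_normsq_def q_def[symmetric]
    using int_q w(2) by (subst nn_integral_eq_integral) (auto simp: q_def)
  then have q_less: "integral\<^sup>L circle q < \<epsilon>\<^sup>2"
  proof -
    have "0 \<le> integral\<^sup>L circle q"
      using w(2) by (intro integral_nonneg_AE AE_I2) (auto simp: q_def)
    moreover have "ennreal (integral\<^sup>L circle q) < ennreal (\<epsilon>\<^sup>2)"
      using p(2) unfolding \<open>ennreal (integral\<^sup>L circle q) = L2_normsq w h\<close> h_def .
    ultimately show ?thesis
      by (simp add: ennreal_less_iff)
  qed
  have pointwise: "norm (h t * of_real (g t)) \<le> C * (\<epsilon> / 2 + q t / (2 * \<epsilon>))" if "t \<in> {0..1}" for t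
  proof -
    have "cmod (h t) \<le> \<epsilon> / 2 + (cmod (h t))\<^sup>2 / (2 * \<epsilon>)"
    proof -
      have "0 \<le> (cmod (h t) - \<epsilon>)\<^sup>2" by simp
      then have "cmod (h t) * (2 * \<epsilon>) \<le> \<epsilon>\<^sup>2 + (cmod (h t))\<^sup>2"
        by (simp add: power2_diff algebra_simps)
      then show ?thesis using eps by (simp add: field_simps power2_eq_square)
    qed
    then have "cmod (h t) * w t \<le> (\<epsilon> / 2 + (cmod (h t))\<^sup>2 / (2 * \<epsilon>)) * w t"
      using w(2)[OF that] by (intro mult_right_mono) auto
    also have "\<dots> \<le> \<epsilon> / 2 + q t / (2 * \<epsilon>)"
      using w(2)[OF that] eps mult_left_mono[of "w t" 1 "\<epsilon> / 2"] by (simp add: q_def algebra_simps)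
    finally have "C * (cmod (h t) * w t) \<le> C * (\<epsilon> / 2 + q t / (2 * \<epsilon>))"
      using C by (intro mult_left_mono) auto
    moreover have "cmod (h t) * \<bar>g t\<bar> \<le> cmod (h t) * (C * w t)"
      using g(2)[OF that] by (intro mult_left_mono) auto
    ultimately show ?thesis by (simp add: norm_mult mult_ac)
  qed
  have "\<bar>I\<bar> = norm (integral\<^sup>L circle (\<lambda>t. h t * of_real (g t)))"
    using \<open>integral\<^sup>L circle (\<lambda>t. h t * of_real (g t)) = of_real I\<close> by simp
  also have "\<dots> \<le> integral\<^sup>L circle (\<lambda>t. norm (h t * of_real (g t)))"
    by (rule integral_norm_bound)
  also have "\<dots> \<le> integral\<^sup>L circle (\<lambda>t. C * (\<epsilon> / 2 + q t / (2 * \<epsilon>)))"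
    using int_hg int_q pointwise by (intro integral_mono) auto
  also have "\<dots> = C * (\<epsilon> / 2 + integral\<^sup>L circle q / (2 * \<epsilon>))"
    using int_q by simp
  also have "\<dots> < C * (\<epsilon> / 2 + \<epsilon>\<^sup>2 / (2 * \<epsilon>))"
    using C eps q_less by (intro mult_strict_left_mono add_strict_left_mono divide_strict_right_mono) auto
  also have "\<dots> = C * \<epsilon>"
    using eps by (simp add: power2_eq_square)
  also have "\<dots> = \<bar>I\<bar> / 2"
    using C by (simp add: \<epsilon>_def)
  finally show False by simp
qed

theorem theorem2:
  "\<exists>w :: real \<Rightarrow> real. is_weight w \<and> condition_A w \<and>
     \<not> spans_L2 (exp_system (real ` ({n. 1 \<le> n} - {k\<^sup>2 | k. 1 \<le> k}))) w"
proof -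
  obtain C d where Cd: "C > 0" "d > 0" and bd: "\<And>t. t \<ge> 0 \<Longrightarrow> \<bar>flat_fun t\<bar> \<le> C * exp (- d / t)"
    using flat_fun_exp_bound by blast
  define w where "w = (\<lambda>t::real. exp (- d / t))"
  define S where "S = exp_system (real ` ({n. 1 \<le> n} - {k\<^sup>2 | k. 1 \<le> k}))"
  have S: "\<exists>n. e = exponential n \<and> n > 0 \<and> (\<forall>k\<ge>1. n \<noteq> int k ^ 2)" if e: "e \<in> S" for e
  proof -
    obtain m :: nat where m: "1 \<le> m" "\<And>k. 1 \<le> k \<Longrightarrow> m \<noteq> k\<^sup>2" and e: "e = (\<lambda>t. exp (2 * of_real pi * \<i> * of_real (real m) * of_real t))"
      using e unfolding S_def exp_system_def by blast
    have "int m \<noteq> int k ^ 2" if "k \<ge> 1" for k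
      using m(2)[OF that] by (metis of_nat_eq_iff of_nat_power)
    then show ?thesis using m(1) by (intro exI[of _ "int m"]) (auto simp: e exponential_def)
  qed
  have "\<not> spans_L2 S w"
  proof (rule not_spans_L2_if_annihilated[where g = flat_fun and C = C])
    show "w \<in> borel_measurable circle" unfolding w_def by (auto intro!: borel_measurable_circle)
    show "flat_fun \<in> borel_measurable circle" by (intro borel_measurable_circle flat_fun_measurable)
    have "complex_of_real (integral\<^sup>L circle flat_fun) = 1"
      using integral_exponential_times_flat_fun(1)[of 0] by (simp add: exponential_def)
    then show "integral\<^sup>L circle flat_fun \<noteq> 0" by auto
    show "continuous_on {0..1} e" if "e \<in> S" for e
      using S[OF that] by (auto intro: continuous_on_exponential)
    show "integral\<^sup>L circle (\<lambda>t. e t * of_real (flat_fun t)) = 0" if e: "e \<in> S" for e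
    proof -
      obtain n where "e = exponential n" "n > 0" "\<forall>k\<ge>1. n \<noteq> int k ^ 2"
        using S[OF e] by blast
      then show ?thesis using integral_exponential_times_flat_fun(1)[of n] by simp
    qed
  qed (use bd Cd in \<open>auto simp: w_def\<close>)
  then show ?thesis
    using is_weight_exp_neg_inverse[OF Cd(2)] condition_A_exp_neg_inverse[OF Cd(2)]
    unfolding w_def S_def by blast
qed

end
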